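(* For each integer $d\geq 2$, the set $\mathrm{PCF}_d\cap\mathbb{Q}^{\mathrm{tr}}$ is finite, where $\mathrm{PCF}_d$ is the set of $c\in\overline{\mathbb{Q}}$ such that $f(x)=x^d+c$ is post-critically finite (the orbit $0,f(0),f^2(0),\dots$ takes only finitely many values) and $\mathbb{Q}^{\mathrm{tr}}$ is the maximal totally real subfield of $\overline{\mathbb{Q}}$.
   Context: $\mathbb{Q}^{\mathrm{tr}}$ is the set of algebraic numbers whose minimal polynomial over $\mathbb{Q}$ has only real roots. *)

theory Defs
  imports Complex_Main "HOL-Computational_Algebra.Computational_Algebra"
begin

text \<open>
  The field of algebraic numbers is taken inside the complex numbers, as the set of all
  \<^term>\<open>c :: complex\<close> with \<^term>\<open>algebraic c\<close>.
\<close>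

definition is_minimal_poly :: "rat poly \<Rightarrow> complex \<Rightarrow> bool" where
  "is_minimal_poly p c \<longleftrightarrow>
     lead_coeff p = 1 \<and> irreducible p \<and> poly (map_poly of_rat p) c = 0"

definition totally_real :: "complex set" where
  "totally_real = {c. algebraic c \<and>
     (\<exists>p. is_minimal_poly p c \<and> (\<forall>z :: complex. poly (map_poly of_rat p) z = 0 \<longrightarrow> z \<in> \<real>))}"

definition PCF :: "nat \<Rightarrow> complex set" where
  "PCF d = {c. algebraic c \<and> finite (range (\<lambda>n. ((\<lambda>x. x ^ d + c) ^^ n) 0))}"

lemma map_poly_of_rat_add:
  "map_poly of_rat (p + q) = (map_poly of_rat p + map_poly of_rat q :: complex poly)"
  by (rule poly_eqI) (simp add: coeff_map_poly of_rat_add)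

lemma map_poly_of_rat_mult:
  "map_poly of_rat (p * q) = (map_poly of_rat p * map_poly of_rat q :: complex poly)"
  by (rule poly_eqI) (simp add: coeff_map_poly coeff_mult of_rat_sum of_rat_mult)

text \<open>The quantifier over \<open>p\<close> in \<^const>\<open>totally_real\<close> ranges over exactly one polynomial.\<close>

lemma ex1_minimal_poly:
  assumes "algebraic c"
  shows "\<exists>!p. is_minimal_poly p c"
proof -
  define R where "R p \<longleftrightarrow> p \<noteq> 0 \<and> poly (map_poly of_rat p) c = 0" for p :: "rat poly"
  obtain q where q: "poly (map_poly of_int q) c = 0" "q \<noteq> 0"
    using assms by (elim algebraicE') auto
  have "map_poly of_rat (map_poly of_int q :: rat poly) = (map_poly of_int q :: complex poly)"
    by (rule poly_eqI) (simp add: coeff_map_poly)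
  moreover have "(map_poly of_int q :: rat poly) \<noteq> 0"
    using q by (simp add: map_poly_eq_0_iff)
  ultimately have ex: "R (map_poly of_int q)"
    using q by (simp add: R_def)
  define p0 where "p0 = (ARG_MIN degree p. R p)"
  have p0: "R p0" and min: "\<And>p. R p \<Longrightarrow> degree p0 \<le> degree p"
    using arg_min_nat_lemma[of R _ degree, OF ex] by (auto simp: p0_def)
  define p where "p = smult (inverse (lead_coeff p0)) p0"
  have "map_poly of_rat p = smult (of_rat (inverse (lead_coeff p0))) (map_poly of_rat p0 :: complex poly)"
    unfolding p_def by (rule poly_eqI) (simp add: coeff_map_poly of_rat_mult)
  with p0 have Rp: "R p" and monic: "lead_coeff p = 1" and deg: "degree p = degree p0"
    by (auto simp: R_def p_def)
  have root_mult: "R a \<or> R b" if "R (a * b)" for a b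
    using that by (auto simp: R_def map_poly_of_rat_mult)
  have "degree p \<noteq> 0"
  proof
    assume "degree p = 0"
    then obtain a where "p = [:a:]" by (rule degree_eq_zeroE)
    with Rp show False by (auto simp: R_def map_poly_pCons)
  qed
  have irr: "irreducible p"
  proof (rule irreducibleI)
    show "p \<noteq> 0" using Rp by (simp add: R_def)
    show "\<not> is_unit p" using \<open>degree p \<noteq> 0\<close> by (simp add: is_unit_iff_degree \<open>p \<noteq> 0\<close>)
    fix a b assume ab: "p = a * b"
    then have nz: "a \<noteq> 0" "b \<noteq> 0" using \<open>p \<noteq> 0\<close> by auto
    then have "degree a + degree b = degree p" by (simp add: ab degree_mult_eq)
    moreover have "degree p \<le> degree a \<or> degree p \<le> degree b"
      using root_mult[of a b] Rp min by (auto simp: ab[symmetric] deg)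
    ultimately have "degree a = 0 \<or> degree b = 0" by auto
    then show "is_unit a \<or> is_unit b" using nz by (simp add: is_unit_iff_degree)
  qed
  show ?thesis
  proof (rule ex1I)
    show "is_minimal_poly p c"
      using monic irr Rp by (simp add: is_minimal_poly_def R_def)
    fix r assume r: "is_minimal_poly r c"
    have "r = r div p * p + r mod p" by simp
    then have "poly (map_poly of_rat r) c = poly (map_poly of_rat (r div p * p + r mod p)) c"
      by simp
    then have "poly (map_poly of_rat (r mod p)) c = 0"
      using r Rp
      unfolding map_poly_of_rat_add map_poly_of_rat_mult is_minimal_poly_def R_def by simp
    moreover have "r mod p = 0 \<or> degree (r mod p) < degree p"
      using Rp degree_mod_less by (auto simp: R_def)
    ultimately have "r mod p = 0"
      using min[of "r mod p"] deg unfolding R_def by (metis not_less)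
    then have "p dvd r" by auto
    then obtain k where k: "r = p * k" ..
    moreover have "\<not> is_unit p" using irr by (simp add: irreducible_def)
    ultimately have "is_unit k"
      using r unfolding is_minimal_poly_def by (metis irreducibleD)
    then obtain u where u: "k = [:u:]" by (auto simp: is_unit_poly_iff)
    with k r monic have "u = 1"
      unfolding is_minimal_poly_def by (auto simp: lead_coeff_mult split: if_splits)
    with k u show "r = p" by simp
  qed
qed

end

theory Submission
  imports Defs "HOL-Computational_Algebra.Field_as_Ring"
begin

text \<open>
  A relation \<open>f\<^sup>n(0) = f\<^sup>m(0)\<close> is a monic polynomial equation over the integers for the parameter, so
  by Gauss's lemma a PCF parameter \<open>c\<close> has a minimal polynomial \<open>P\<close> with integer coefficients, and
  every conjugate of \<open>c\<close> satisfies the same relation. If \<open>c\<close> is totally real, the conjugates are thus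
  real parameters with a non-escaping critical orbit, and these are confined to an interval so short that
  \<open>\<Prod>\<^sub>a\<^sub>\<in>\<^sub>A \<bar>t - a\<bar> < 1\<close> on it for a suitable finite set \<open>A\<close> of integers. Multiplying over all conjugates
  \<open>t\<close> gives \<open>\<Prod>\<^sub>a\<^sub>\<in>\<^sub>A \<bar>P(a)\<bar> < 1\<close>. As this is an integer, \<open>P\<close> vanishes at some \<open>a \<in> A\<close>, that is, \<open>c = a\<close>.
\<close>

section \<open>Polynomials with integer coefficients\<close>

lemma poly_map_poly_of_int_of_int:
  "poly (map_poly of_int p) (of_int x :: 'a :: comm_ring_1) = of_int (poly p x)"
  by (induction p) (simp_all add: map_poly_pCons)

lemma map_poly_of_int_mult:
  "(map_poly of_int (p * q) :: 'a :: {comm_ring_1, ring_char_0} poly) = map_poly of_int p * map_poly of_int q"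
  by (rule poly_eqI) (simp add: coeff_map_poly coeff_mult)

lemma map_poly_of_int_eq_iff:
  "(map_poly of_int p :: 'a :: {comm_ring_1, ring_char_0} poly) = map_poly of_int q \<longleftrightarrow> p = q"
  by (simp add: poly_eq_iff coeff_map_poly)

lemma map_poly_of_rat_of_int:
  "map_poly of_rat (map_poly of_int p) = (map_poly of_int p :: 'a :: field_char_0 poly)"
  by (rule poly_eqI) (simp add: coeff_map_poly)

lemma rat_poly_clear_denominators:
  fixes p :: "rat poly"
  obtains k P where "k > 0" "smult (of_int k) p = map_poly of_int P"
proof -
  have "\<exists>k P. k > 0 \<and> smult (of_int k) p = map_poly of_int P"
  proof (induction p)
    case 0
    show ?case by (intro exI[of _ 1] exI[of _ 0]) simp
  next
    case (pCons c p)
    then obtain k P where k: "k > 0" "smult (of_int k) p = map_poly of_int P" by blast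
    obtain a b where ab: "c = of_int a / of_int b" "b > 0"
      by (metis quotient_of_div quotient_of_denom_pos surj_pair)
    have "smult (of_int (b * k)) (pCons c p) = map_poly of_int (pCons (a * k) (smult b P))"
      using ab k(2) by (simp add: map_poly_pCons map_poly_smult flip: smult_smult)
    with ab k(1) show ?case by (meson mult_pos_pos)
  qed
  with that show ?thesis by blast
qed

text \<open>Contents are multiplicative and \<open>G\<close> is primitive, so
  \<open>content A * content B = a * b\<close>. As \<open>p\<close> and \<open>r\<close> are monic,
  \<open>a\<close> and \<open>b\<close> occur as coefficients of \<open>A\<close> and
  \<open>B\<close>, so \<open>content A dvd a\<close> and \<open>content B dvd b\<close>. Comparing
  the products, \<open>a\<close> divides \<open>content A\<close> and can be cancelled from
  \<open>A\<close>.\<close>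

lemma monic_factor_of_int_poly:
  fixes p :: "rat poly"
  assumes p: "lead_coeff p = 1" and dvd: "p dvd map_poly of_int G" and G: "lead_coeff G = 1"
  obtains P where "p = map_poly of_int P"
proof -
  from dvd obtain r where r: "map_poly of_int G = p * r" ..
  have "lead_coeff (map_poly of_int G :: rat poly) = 1"
    using G by (simp add: lead_coeff_map_poly_nz)
  with r p have lr: "lead_coeff r = 1" by (simp add: lead_coeff_mult)
  obtain a A where a: "a > 0" "smult (of_int a) p = map_poly of_int A"
    by (rule rat_poly_clear_denominators)
  obtain b B where b: "b > 0" "smult (of_int b) r = map_poly of_int B"
    by (rule rat_poly_clear_denominators)
  have "map_poly of_int (A * B) = (map_poly of_int (smult (a * b) G) :: rat poly)"
    using a(2) b(2) r by (simp add: map_poly_of_int_mult map_poly_smult mult_ac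
        flip: a(2) b(2))
  then have AB: "A * B = smult (a * b) G" by (simp add: map_poly_of_int_eq_iff)
  have "content G dvd lead_coeff G" by (rule content_dvd_coeff)
  with G have "is_unit (content G)" by simp
  then have "content G = 1" using is_unit_normalize[of "content G"] unfolding normalize_content by blast
  then have cAB: "content A * content B = a * b"
    using arg_cong[OF AB, of content] a b by (simp add: content_mult)
  have "coeff (map_poly of_int A) (degree p) = (of_int a :: rat)"
    using p by (simp flip: a(2))
  then have "coeff A (degree p) = a" by (simp add: coeff_map_poly)
  then have ca: "content A dvd a" by (metis content_dvd_coeff)
  have "coeff (map_poly of_int B) (degree r) = (of_int b :: rat)"
    using lr by (simp flip: b(2))
  then have "coeff B (degree r) = b" by (simp add: coeff_map_poly)
  then have "content B dvd b" by (metis content_dvd_coeff)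
  then have "a * content B dvd a * b" by simp
  with cAB b have "a * content B dvd content A * content B" "content B \<noteq> 0"
    using a by auto
  then have "a dvd content A" by simp
  then have "[:a:] dvd A" by (metis content_dvd dvd_trans const_poly_dvd_const_poly_iff)
  then obtain P where "A = smult a P" by (auto elim: dvdE)
  then have "smult (of_int a) p = smult (of_int a) (map_poly of_int P)"
    using a by (simp add: map_poly_smult)
  then have "smult (inverse (of_int a)) (smult (of_int a) p)
      = smult (inverse (of_int a)) (smult (of_int a) (map_poly of_int P))"
    by simp
  then have "p = map_poly of_int P" using a(1) by simp
  with that show ?thesis .
qed

section \<open>Minimal polynomials over the rationals\<close>

lemma minimal_poly_dvd:
  assumes p: "is_minimal_poly p c" and q: "poly (map_poly of_rat q) c = 0"
  shows "p dvd q"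
proof (rule ccontr)
  assume "\<not> p dvd q"
  moreover have "prime_elem p"
    using p by (simp add: is_minimal_poly_def field_poly_irreducible_imp_prime)
  ultimately have "coprime p q" by (metis prime_elem_imp_coprime)
  then obtain u v where "u * p + v * q = 1"
    by (metis bezout_coefficients_fst_snd coprime_imp_gcd_eq_1)
  then have "poly (map_poly of_rat (u * p + v * q)) c = poly (map_poly of_rat 1) c" by simp
  then show False
    using p q unfolding map_poly_of_rat_add map_poly_of_rat_mult is_minimal_poly_def by simp
qed

text \<open>Irreducibility leaves only a constant cofactor next to \<open>[:-a, 1:]\<close>, so no
  root other than \<open>a\<close> remains.\<close>

lemma minimal_poly_rational_root:
  assumes p: "is_minimal_poly p c" and root: "poly p a = 0"
  shows "c = of_rat a"
proof -
  from root obtain k where k: "p = [:-a, 1:] * k" by (metis dvdE poly_eq_0_iff_dvd)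
  moreover have "\<not> is_unit [:-a, 1:]" by (simp add: is_unit_poly_iff)
  ultimately have "is_unit k"
    using p unfolding is_minimal_poly_def by (metis irreducibleD)
  then obtain u where u: "k = [:u:]" "u \<noteq> 0" by (force simp: is_unit_poly_iff)
  have "poly (map_poly of_rat p) c = (c - of_rat a) * of_rat u"
    unfolding k map_poly_of_rat_mult u
    by (simp add: map_poly_pCons of_rat_minus algebra_simps)
  with p u show ?thesis by (simp add: is_minimal_poly_def)
qed

section \<open>Values of a polynomial as products over its roots\<close>

text \<open>Exchanging the two products turns values at the points of \<open>A\<close> into
  distances from the roots, so that a bound at each single root suffices.\<close>

lemma prod_norm_poly_roots:
  fixes Z :: "complex multiset"
  shows "(\<Prod>a\<in>A. norm (poly (\<Prod>z\<in>#Z. [:-z, 1:]) a)) = (\<Prod>z\<in>#Z. \<Prod>a\<in>A. norm (z - a))"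
proof (induction Z)
  case (add z Z)
  have "norm (poly [:-z, 1:] a) = norm (z - a)" for a
    by (simp add: norm_minus_commute)
  with add show ?case
    by (simp only: image_mset_add_mset prod_mset.add_mset poly_mult norm_mult prod.distrib)
qed simp

lemma prod_mset_less_one:
  fixes g :: "'b \<Rightarrow> real"
  assumes "Z \<noteq> {#}" "\<And>z. z \<in># Z \<Longrightarrow> 0 \<le> g z" "\<And>z. z \<in># Z \<Longrightarrow> g z < 1"
  shows "prod_mset (image_mset g Z) < 1"
  using assms
proof (induction Z)
  case (add z Z)
  show ?case
  proof (cases "Z = {#}")
    case True
    with add.prems show ?thesis by simp
  next
    case False
    with add have "prod_mset (image_mset g Z) < 1" by auto
    moreover have "(\<forall>z\<in>#Z. 0 \<le> g z) \<longrightarrow> 0 \<le> prod_mset (image_mset g Z)"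
      by (induction Z) auto
    then have "0 \<le> prod_mset (image_mset g Z)" using add.prems(2) by auto
    moreover have "0 \<le> g z" "g z < 1" using add.prems by auto
    ultimately show ?thesis
      using mult_left_le_one_le[of "prod_mset (image_mset g Z)" "g z"] by simp
  qed
qed simp

lemma prod_norm_poly_less_one:
  fixes P :: "complex poly"
  assumes "lead_coeff P = 1" "degree P > 0"
    and roots: "\<And>z. poly P z = 0 \<Longrightarrow> (\<Prod>a\<in>A. norm (z - a)) < 1"
  shows "(\<Prod>a\<in>A. norm (poly P a)) < 1"
proof -
  have "P \<noteq> 0" using assms by auto
  \<comment> \<open>\<open>Z\<close> holds the complex roots with multiplicity.\<close>
  then obtain Z where Z: "size Z = degree P" "P = (\<Prod>z\<in>#Z. [:-z, 1:])"
    using alg_closed_imp_factorization[of P] assms(1) by auto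
  have "poly P z = 0" if "z \<in># Z" for z
    using that by (subst Z(2)) (auto dest!: multi_member_split)
  moreover have "Z \<noteq> {#}" using Z(1) assms(2) by auto
  ultimately have "(\<Prod>z\<in>#Z. \<Prod>a\<in>A. norm (z - a)) < 1"
    using roots by (intro prod_mset_less_one) (auto intro: prod_nonneg)
  then show ?thesis unfolding Z(2) prod_norm_poly_roots .
qed

lemma small_minimal_int_poly:
  fixes A :: "int set"
  assumes p: "is_minimal_poly (map_poly of_int P) c" and "finite A"
    and roots: "\<And>z :: complex. poly (map_poly of_int P) z = 0 \<Longrightarrow> (\<Prod>a\<in>A. norm (z - of_int a)) < 1"
  shows "c \<in> of_int ` A"
proof -
  have monic: "lead_coeff P = 1"
    using p by (simp add: is_minimal_poly_def coeff_map_poly degree_map_poly)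
  have c: "poly (map_poly of_int P) c = 0"
    using p by (simp add: is_minimal_poly_def map_poly_of_rat_of_int)
  have "degree P \<noteq> 0"
  proof
    assume "degree P = 0"
    then obtain u where "P = [:u:]" by (rule degree_eq_zeroE)
    with monic c show False by (simp add: map_poly_pCons)
  qed
  \<comment> \<open>Injectivity ensures that passing to the image of \<open>A\<close> merges no
    factors.\<close>
  moreover have "inj_on (of_int :: int \<Rightarrow> complex) A" by (auto intro: inj_onI)
  ultimately have "(\<Prod>a\<in>of_int ` A. norm (poly (map_poly of_int P) a :: complex)) < 1"
    using monic roots
    by (intro prod_norm_poly_less_one) (auto simp: coeff_map_poly degree_map_poly prod.reindex)
  with \<open>inj_on _ A\<close> have "(\<Prod>a\<in>A. norm (poly (map_poly of_int P) (of_int a) :: complex)) < 1"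
    by (simp add: prod.reindex)
  then have "of_int (\<Prod>a\<in>A. \<bar>poly P a\<bar>) < (1 :: real)"
    by (simp add: poly_map_poly_of_int_of_int)
  then have "(\<Prod>a\<in>A. \<bar>poly P a\<bar>) < 1" by linarith
  moreover have "(\<Prod>a\<in>A. \<bar>poly P a\<bar>) \<ge> 0" by (simp add: prod_nonneg)
  ultimately have "(\<Prod>a\<in>A. \<bar>poly P a\<bar>) = 0" by linarith
  then obtain a where a: "a \<in> A" "poly P a = 0" using \<open>finite A\<close> by auto
  then have "poly (map_poly of_int P) (of_int a :: rat) = 0"
    by (simp add: poly_map_poly_of_int_of_int)
  from minimal_poly_rational_root[OF p this] a(1) show ?thesis by simp
qed

section \<open>The critical orbit as a polynomial in the parameter\<close>

text \<open>The ring is left generic: at \<open>[:0, 1:]\<close> over the integers this is the orbit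
  as a polynomial in the parameter, at a real or complex number it is the orbit itself.\<close>

definition crit_orbit :: "nat \<Rightarrow> 'a :: comm_ring_1 \<Rightarrow> nat \<Rightarrow> 'a" where
  "crit_orbit d c n = ((\<lambda>x. x ^ d + c) ^^ n) 0"

lemma crit_orbit_0 [simp]: "crit_orbit d c 0 = 0"
  and crit_orbit_Suc: "crit_orbit d c (Suc n) = crit_orbit d c n ^ d + c"
  by (simp_all add: crit_orbit_def)

lemma crit_orbit_of_real:
  "crit_orbit d (of_real t :: 'a :: {real_algebra_1, comm_ring_1}) n = of_real (crit_orbit d t n)"
  by (induction n) (simp_all add: crit_orbit_Suc)

text \<open>Evaluation is a ring homomorphism and so commutes with the recursion. This is how one
  orbit relation becomes a polynomial equation shared by all conjugates.\<close>

lemma poly_crit_orbit: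
  "poly (map_poly of_int (crit_orbit d [:0, 1:] n)) (c :: 'a :: {comm_ring_1, ring_char_0}) = crit_orbit d c n"
proof (induction n)
  case (Suc n)
  have power: "map_poly of_int (p ^ k) = (map_poly of_int p ^ k :: 'a poly)" for p k
    by (induction k) (simp_all add: map_poly_of_int_mult)
  have add: "map_poly of_int (p + q) = (map_poly of_int p + map_poly of_int q :: 'a poly)" for p q
    by (rule poly_eqI) (simp add: coeff_map_poly)
  from Suc show ?case
    by (simp add: crit_orbit_Suc power add map_poly_pCons)
qed simp

lemma crit_orbit_poly_degree:
  assumes "d \<ge> 2"
  shows "degree (crit_orbit d [:0, 1 :: int:] (Suc n)) = d ^ n \<and>
    lead_coeff (crit_orbit d [:0, 1 :: int:] (Suc n)) = 1"
proof (induction n)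
  case 0
  from assms show ?case by (simp add: crit_orbit_Suc zero_power)
next
  case (Suc n)
  let ?q = "crit_orbit d [:0, 1 :: int:] (Suc n)"
  have "?q \<noteq> 0" using Suc by auto
  then have deg: "degree (?q ^ d) = d ^ Suc n" using Suc by (simp add: degree_power_eq)
  have lead: "lead_coeff (?q ^ d) = 1" using conjunct2[OF Suc] by (simp only: lead_coeff_power power_one)
  \<comment> \<open>The added parameter has degree 1, so a power of degree at least 2 keeps its
    leading term.\<close>
  have "2 \<le> d ^ Suc n" using assms self_le_power[of d "Suc n"] by linarith
  then have "degree [:0, 1 :: int:] < degree (?q ^ d)" using deg by simp
  then have "degree ([:0, 1:] + ?q ^ d) = degree (?q ^ d)"
    "lead_coeff ([:0, 1:] + ?q ^ d) = lead_coeff (?q ^ d)"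
    by (rule degree_add_eq_right, rule lead_coeff_add_le)
  moreover have "crit_orbit d [:0, 1:] (Suc (Suc n)) = [:0, 1:] + ?q ^ d"
    by (simp only: crit_orbit_Suc[of d "[:0, 1:]" "Suc n"] add.commute)
  ultimately show ?case using deg lead by (simp only: simp_thms)
qed

lemma crit_orbit_poly_diff_monic:
  assumes "d \<ge> 2" "m < n"
  shows "lead_coeff (crit_orbit d [:0, 1 :: int:] n - crit_orbit d [:0, 1:] m) = 1"
proof -
  let ?q = "crit_orbit d [:0, 1 :: int:]"
  obtain n' where n: "n = Suc n'" using assms by (cases n) auto
  have "degree (?q m) < degree (?q n)"
  proof (cases m)
    \<comment> \<open>Here \<open>?q m\<close> is the zero polynomial, of degree 0, while
      \<open>?q n\<close> has positive degree \<open>d ^ n'\<close>.\<close>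
    case 0
    with n show ?thesis using crit_orbit_poly_degree[OF assms(1), of n'] assms(1) by simp
  next
    case (Suc m')
    with n assms show ?thesis
      using crit_orbit_poly_degree[OF assms(1), of n'] crit_orbit_poly_degree[OF assms(1), of m']
      by (simp add: power_strict_increasing)
  qed
  then have "lead_coeff (- ?q m + ?q n) = lead_coeff (?q n)"
    by (intro lead_coeff_add_le) simp
  also have "\<dots> = 1" using n crit_orbit_poly_degree[OF assms(1)] by blast
  finally show ?thesis by (simp only: uminus_add_conv_diff)
qed

section \<open>Real parameters with a finite critical orbit\<close>

text \<open>Once \<bar>x\<bar> \<ge> \<bar>t\<bar>, the hypothesis makes \<bar>x^d\<bar> exceed
  2\<bar>x\<bar>, and adding \<open>t\<close> takes away at most \<bar>x\<bar>. Absolute values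
  therefore grow strictly.\<close>

lemma crit_orbit_escape:
  fixes t :: real
  assumes "\<bar>t\<bar> ^ (d - 1) > 2" "d \<ge> 2"
  shows "inj (crit_orbit d t)"
proof -
  let ?x = "crit_orbit d t"
  have t: "t \<noteq> 0" using assms by (auto simp: power_0_left)
  have step: "\<bar>x\<bar> < \<bar>x ^ d + t\<bar>" if "\<bar>t\<bar> \<le> \<bar>x\<bar>" for x
  proof -
    have "\<bar>t\<bar> ^ (d - 1) \<le> \<bar>x\<bar> ^ (d - 1)" using that by (intro power_mono) auto
    then have "2 < \<bar>x\<bar> ^ (d - 1)" using assms by linarith
    then have "\<bar>x\<bar> * 2 < \<bar>x\<bar> * \<bar>x\<bar> ^ (d - 1)"
      using that t by (intro mult_strict_left_mono) auto
    also have "\<dots> = \<bar>x ^ d\<bar>"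
      using assms(2) by (simp add: power_abs flip: power_Suc)
    finally show ?thesis using that by linarith
  qed
  \<comment> \<open>The orbit starts at 0, below \<bar>t\<bar>; the threshold is reached at index 1,
    where the value is \<open>t\<close>.\<close>
  have ge: "\<bar>t\<bar> \<le> \<bar>?x (Suc n)\<bar>" for n
  proof (induction n)
    case 0
    from assms show ?case by (simp add: crit_orbit_Suc zero_power)
  next
    case (Suc n)
    from step[OF this] this show ?case by (simp add: crit_orbit_Suc)
  qed
  have "\<bar>?x n\<bar> < \<bar>?x (Suc n)\<bar>" for n
  proof (cases n)
    case 0
    with t assms show ?thesis by (simp add: crit_orbit_Suc zero_power)
  next
    case (Suc k)
    with step[OF ge[of k]] show ?thesis by (simp add: crit_orbit_Suc)
  qed
  then have "strict_mono (\<lambda>n. \<bar>?x n\<bar>)" by (simp add: strict_mono_Suc_iff)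
  then have "inj (\<lambda>n. \<bar>?x n\<bar>)" by (rule strict_mono_imp_inj_on)
  then show ?thesis by (auto simp: inj_def)
qed

text \<open>Since x^2 + t - x = (x - 1/2)^2 + (t - 1/4) is positive, there is no real fixed point
  and the orbit increases.\<close>

lemma crit_orbit_square_escape:
  fixes t :: real
  assumes "t > 1 / 4"
  shows "inj (crit_orbit 2 t)"
proof -
  have "x < x\<^sup>2 + t" for x
  proof -
    have "0 \<le> (x - 1 / 2)\<^sup>2" by simp
    with assms show ?thesis by (simp add: power2_eq_square algebra_simps)
  qed
  then have "strict_mono (crit_orbit 2 t)" by (simp add: strict_mono_Suc_iff crit_orbit_Suc)
  then show ?thesis by (rule strict_mono_imp_inj_on)
qed

text \<open>For odd \<open>d\<close>, negation conjugates the maps with parameters \<open>t\<close>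
  and \<open>-t\<close>, so bounding positive parameters is enough.\<close>

lemma crit_orbit_odd:
  assumes "odd d"
  shows "crit_orbit d (- t) n = - crit_orbit d t n"
  using assms by (induction n) (simp_all add: crit_orbit_Suc)

text \<open>The general escape bound only gives t^2 \<le> 2 for cubes. The threshold 1 is not sharp,
  but it makes the single integer 0 suffice.\<close>

lemma crit_orbit_cube_escape:
  fixes t :: real
  assumes "t \<ge> 1"
  shows "inj (crit_orbit 3 t)"
proof -
  have nonneg: "crit_orbit 3 t n \<ge> 0" for n
    using assms by (induction n) (simp_all add: crit_orbit_Suc)
  have "x < x ^ 3 + t" if "x \<ge> 0" for x
  proof (cases "x < 1")
    case True
    with that assms show ?thesis by (cases "x = 0") (auto simp: add_pos_pos add_strict_increasing)
  next
    case False
    then have "x ^ 1 \<le> x ^ 3" by (intro power_increasing) auto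
    with assms show ?thesis by simp
  qed
  with nonneg have "strict_mono (crit_orbit 3 t)" by (simp add: strict_mono_Suc_iff crit_orbit_Suc)
  then show ?thesis by (rule strict_mono_imp_inj_on)
qed

section \<open>Products of distances to nearby integers\<close>

text \<open>The product is \<bar>x^3 - x\<bar>. If \<bar>x\<bar> > 1, it is below \<bar>x\<bar>^3 -
  1 \<le> 1; if \<bar>x\<bar> < 1, it is at most \<bar>x\<bar>.\<close>

lemma abs_cube_minus_self_less_one:
  fixes x :: real
  assumes "\<bar>x\<bar> ^ 3 \<le> 2"
  shows "\<bar>x - 1\<bar> * (\<bar>x\<bar> * \<bar>x + 1\<bar>) < 1"
proof -
  have eq: "\<bar>x - 1\<bar> * (\<bar>x\<bar> * \<bar>x + 1\<bar>) = \<bar>\<bar>x\<bar> ^ 3 - \<bar>x\<bar>\<bar>"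
  proof -
    have "\<bar>x - 1\<bar> * (\<bar>x\<bar> * \<bar>x + 1\<bar>) = \<bar>x ^ 3 - x\<bar>"
      by (simp add: power3_eq_cube algebra_simps flip: abs_mult)
    then show ?thesis by (cases "x \<ge> 0") (auto simp: abs_minus_commute)
  qed
  have "\<bar>x\<bar> ^ 3 - \<bar>x\<bar> < 1"
  proof (cases "\<bar>x\<bar> > 1")
    case False
    then have "\<bar>x\<bar> ^ 3 \<le> \<bar>x\<bar> ^ 1" by (intro power_decreasing) auto
    then show ?thesis by simp
  qed (use assms in linarith)
  moreover have "\<bar>x\<bar> - \<bar>x\<bar> ^ 3 < 1"
  proof (cases "\<bar>x\<bar> < 1")
    case True
    then show ?thesis by (smt (verit) zero_le_power)
  next
    case False
    then have "\<bar>x\<bar> ^ 1 \<le> \<bar>x\<bar> ^ 3" by (intro power_increasing) auto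
    then show ?thesis by simp
  qed
  ultimately show ?thesis unfolding eq by linarith
qed

lemma real_parameter_near_integers:
  assumes "d \<ge> 2"
  obtains A :: "int set" where "finite A"
    "\<And>t. \<not> inj (crit_orbit d t) \<Longrightarrow> (\<Prod>a\<in>A. \<bar>t - of_int a\<bar>) < (1 :: real)"
proof -
  consider "d = 2" | "d = 3" | "d \<ge> 4" using assms by linarith
  then show ?thesis
  proof cases
    case 1
    \<comment> \<open>The two escape bounds confine \<open>t\<close> to [-2, 1/4], within 5/4 of -1,
      and (5/4)^3 = 125/64 < 2. The cubic bound is therefore applied at \<open>t + 1\<close>, which
      centres the three integers at -1.\<close>
    have "(\<Prod>a\<in>{0, -1, -2}. \<bar>t - of_int a\<bar>) < 1" if "\<not> inj (crit_orbit d t)" for t :: real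
    proof -
      have "\<bar>t\<bar> \<le> 2" using crit_orbit_escape[of t d] that 1 by fastforce
      moreover have "t \<le> 1 / 4" using crit_orbit_square_escape[of t] that 1 by fastforce
      ultimately have "\<bar>t + 1\<bar> \<le> 5 / 4" by linarith
      then have "\<bar>t + 1\<bar> ^ 3 \<le> (5 / 4) ^ 3" by (intro power_mono) auto
      then have "\<bar>t + 1\<bar> ^ 3 \<le> 2" by (simp add: power3_eq_cube)
      from abs_cube_minus_self_less_one[OF this] show ?thesis by (simp add: add.assoc)
    qed
    then show ?thesis by (intro that[of "{0, -1, -2}"]) auto
  next
    case 2
    have "\<bar>t\<bar> < 1" if "\<not> inj (crit_orbit d t)" for t :: real
    proof -
      have "\<not> inj (crit_orbit d (- t))"
        using that 2 by (auto simp: crit_orbit_odd inj_def)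
      with that show ?thesis
        using crit_orbit_cube_escape[of t] crit_orbit_cube_escape[of "- t"] 2 by fastforce
    qed
    then show ?thesis by (intro that[of "{0}"]) auto
  next
    case 3
    have "(\<Prod>a\<in>{1, 0, -1}. \<bar>t - of_int a\<bar>) < 1" if "\<not> inj (crit_orbit d t)" for t :: real
    proof -
      have le: "\<bar>t\<bar> ^ (d - 1) \<le> 2" using crit_orbit_escape[of t d] that 3 by fastforce
      \<comment> \<open>For \<bar>t\<bar> > 1, lowering the exponent from d - 1 \<ge> 3 to 3 only
        decreases the power, so one set serves all \<open>d\<close> from 4 on.\<close>
      have "\<bar>t\<bar> ^ 3 \<le> 2"
      proof (cases "\<bar>t\<bar> \<le> 1")
        case True
        then have "\<bar>t\<bar> ^ 3 \<le> 1" by (intro power_le_one) auto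
        then show ?thesis by simp
      next
        case False
        with 3 have "\<bar>t\<bar> ^ 3 \<le> \<bar>t\<bar> ^ (d - 1)" by (intro power_increasing) auto
        with le show ?thesis by simp
      qed
      from abs_cube_minus_self_less_one[OF this] show ?thesis by simp
    qed
    then show ?thesis by (intro that[of "{1, 0, -1}"]) auto
  qed
qed

section \<open>From the conjugates of a parameter to finiteness\<close>

theorem theorem4p1:
  fixes d :: nat
  assumes "d \<ge> 2"
  shows "finite (PCF d \<inter> totally_real)"
proof -
  obtain A :: "int set" where "finite A"
    and A: "\<And>t. \<not> inj (crit_orbit d t) \<Longrightarrow> (\<Prod>a\<in>A. \<bar>t - of_int a\<bar>) < (1 :: real)"
    using real_parameter_near_integers[OF assms] by blast
  have "c \<in> of_int ` A" if "c \<in> PCF d" and "c \<in> totally_real" for c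
  proof -
    obtain p where p: "is_minimal_poly p c"
      and real: "\<And>z :: complex. poly (map_poly of_rat p) z = 0 \<Longrightarrow> z \<in> \<real>"
      using \<open>c \<in> totally_real\<close> by (auto simp: totally_real_def)
    have "finite (range (crit_orbit d c))"
      using \<open>c \<in> PCF d\<close> by (simp add: PCF_def crit_orbit_def)
    then have "\<not> inj (crit_orbit d c)" by (meson finite_imageD infinite_UNIV_nat)
    then obtain m n where mn: "m < n" "crit_orbit d c n = crit_orbit d c m"
      by (metis injI linorder_neqE_nat)
    \<comment> \<open>The order \<open>m < n\<close> makes \<open>G\<close> monic, which is what
      forces its factor \<open>p\<close> to have integer coefficients.\<close>
    define G where "G = crit_orbit d [:0, 1 :: int:] n - crit_orbit d [:0, 1:] m"
    have poly_G: "poly (map_poly of_int G) z = crit_orbit d z n - crit_orbit d z m" for z :: complex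
    proof -
      have "map_poly of_int (q - r) = (map_poly of_int q - map_poly of_int r :: complex poly)" for q r
        by (rule poly_eqI) (simp add: coeff_map_poly)
      then show ?thesis by (simp add: G_def poly_crit_orbit)
    qed
    have dvd: "p dvd map_poly of_int G"
      by (rule minimal_poly_dvd[OF p]) (simp add: map_poly_of_rat_of_int poly_G mn)
    moreover have "lead_coeff G = 1"
      unfolding G_def using assms mn(1) by (rule crit_orbit_poly_diff_monic)
    ultimately obtain P where P: "p = map_poly of_int P"
      using p unfolding is_minimal_poly_def by (blast elim: monic_factor_of_int_poly)
    have "(\<Prod>a\<in>A. norm (z - of_int a)) < 1" if z: "poly (map_poly of_int P) z = 0" for z :: complex
    proof -
      \<comment> \<open>A conjugate \<open>z\<close> is real by assumption and a root of
        \<open>G\<close> because \<open>p\<close> divides \<open>G\<close>; so its real critical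
        orbit repeats at the same indices \<open>m\<close> and \<open>n\<close>.\<close>
      have z': "poly (map_poly of_rat p) z = 0" using z by (simp add: P map_poly_of_rat_of_int)
      then obtain t where t: "z = of_real t" using real by (auto elim: Reals_cases)
      obtain r where "map_poly of_int G = p * r" using dvd ..
      then have "map_poly of_rat (map_poly of_int G) = (map_poly of_rat p * map_poly of_rat r :: complex poly)"
        by (simp add: map_poly_of_rat_mult)
      with z' have "poly (map_poly of_int G) z = 0" by (simp add: map_poly_of_rat_of_int)
      then have "crit_orbit d t n = crit_orbit d t m"
        by (simp add: poly_G t crit_orbit_of_real)
      with mn(1) have "\<not> inj (crit_orbit d t)" by (auto dest: injD)
      moreover have "norm (z - of_int a) = \<bar>t - of_int a\<bar>" for a
        unfolding t by (metis norm_of_real of_real_diff of_real_of_int_eq)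
      ultimately show ?thesis using A by simp
    qed
    with p \<open>finite A\<close> show ?thesis unfolding P by (intro small_minimal_int_poly)
  qed
  then have "PCF d \<inter> totally_real \<subseteq> of_int ` A" by blast
  with \<open>finite A\<close> show ?thesis by (meson finite_imageI finite_subset)
qed

end
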